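(* Every metrically projective normed space is isometrically isomorphic to $l_1^0(M)$ for some set $M$.
   Context: Normed spaces are over $\mathbb{C}$ and are not assumed complete. An operator $\tau:Y\to X$ between normed spaces is strictly coisometric if it maps the closed unit ball of $Y$ onto the closed unit ball of $X$. A normed space $P$ is metrically projective if for every strictly coisometric linear operator $\tau:Y\to X$ between normed spaces, every bounded linear operator $\varphi:P\to X$ has a lifting across $\tau$ of the same norm, i.e. a bounded linear operator $\psi:P\to Y$ with $\tau\psi=\varphi$ and $\|\psi\|=\|\varphi\|$. $l_1^0(M)$ is the normed subspace of $l_1(M)$ consisting of finitely supported functions on the set $M$. *)

theory Defs
  imports "HOL-Analysis.Analysis" "HOL-Algebra.Module"
begin

section \<open>Complex normed spaces with explicit carriers\<close>

text \<open>Metric projectivity quantifies over all normed spaces, hence over objects rather than over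
  instances of a type class.  We therefore put a norm on top of the modules of HOL-Algebra.  The
  record fields \<open>mult\<close> and \<open>one\<close>, which modules inherit from rings, are not constrained.\<close>

record 'a normed_module = "(complex, 'a) module" +
  nrm :: "'a \<Rightarrow> real"

definition complex_ring :: "complex ring" where
  "complex_ring = \<lparr>carrier = UNIV, mult = (*), one = 1, zero = 0, add = (+)\<rparr>"

locale complex_normed_space = module complex_ring V
  for V :: "'a normed_module" (structure) +
  assumes nrm_eq_zero_iff: "x \<in> carrier V \<Longrightarrow> nrm V x = 0 \<longleftrightarrow> x = \<zero>"
    and nrm_triangle: "\<lbrakk>x \<in> carrier V; y \<in> carrier V\<rbrakk> \<Longrightarrow> nrm V (x \<oplus> y) \<le> nrm V x + nrm V y"
    and nrm_smult: "x \<in> carrier V \<Longrightarrow> nrm V (c \<odot> x) = norm c * nrm V x"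

definition unit_ball :: "'a normed_module \<Rightarrow> 'a set" where
  "unit_ball V = {x \<in> carrier V. nrm V x \<le> 1}"

text \<open>Operators are functions on the ambient types; only their values on the carrier matter.\<close>

definition linear_operator :: "'a normed_module \<Rightarrow> 'b normed_module \<Rightarrow> ('a \<Rightarrow> 'b) \<Rightarrow> bool" where
  "linear_operator V W T \<longleftrightarrow>
     T \<in> carrier V \<rightarrow> carrier W \<and>
     (\<forall>x\<in>carrier V. \<forall>y\<in>carrier V. T (x \<oplus>\<^bsub>V\<^esub> y) = T x \<oplus>\<^bsub>W\<^esub> T y) \<and>
     (\<forall>c. \<forall>x\<in>carrier V. T (c \<odot>\<^bsub>V\<^esub> x) = c \<odot>\<^bsub>W\<^esub> T x)"

definition bounded_operator :: "'a normed_module \<Rightarrow> 'b normed_module \<Rightarrow> ('a \<Rightarrow> 'b) \<Rightarrow> bool" where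
  "bounded_operator V W T \<longleftrightarrow>
     linear_operator V W T \<and> (\<exists>K. \<forall>x\<in>carrier V. nrm W (T x) \<le> K * nrm V x)"

definition operator_norm :: "'a normed_module \<Rightarrow> 'b normed_module \<Rightarrow> ('a \<Rightarrow> 'b) \<Rightarrow> real" where
  "operator_norm V W T = (SUP x\<in>unit_ball V. nrm W (T x))"

definition isometrically_isomorphic :: "'a normed_module \<Rightarrow> 'b normed_module \<Rightarrow> bool" where
  "isometrically_isomorphic V W \<longleftrightarrow>
     (\<exists>T. linear_operator V W T \<and> bij_betw T (carrier V) (carrier W) \<and>
          (\<forall>x\<in>carrier V. nrm W (T x) = nrm V x))"

section \<open>Metric projectivity\<close>

definition strictly_coisometric ::
  "'a normed_module \<Rightarrow> 'b normed_module \<Rightarrow> ('a \<Rightarrow> 'b) \<Rightarrow> bool" where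
  "strictly_coisometric Y X \<tau> \<longleftrightarrow> \<tau> ` unit_ball Y = unit_ball X"

text \<open>Metric projectivity with respect to all test spaces \<open>Y\<close> and \<open>X\<close> whose carriers are sets of
  elements of the two given types.\<close>

definition metrically_projective_wrt ::
  "'y itself \<Rightarrow> 'x itself \<Rightarrow> 'p normed_module \<Rightarrow> bool" where
  "metrically_projective_wrt TY TX P \<longleftrightarrow>
     (\<forall>(Y :: 'y normed_module) (X :: 'x normed_module) \<tau> \<phi>.
        complex_normed_space Y \<longrightarrow> complex_normed_space X \<longrightarrow>
        linear_operator Y X \<tau> \<longrightarrow> strictly_coisometric Y X \<tau> \<longrightarrow> bounded_operator P X \<phi> \<longrightarrow>
        (\<exists>\<psi>. bounded_operator P Y \<psi> \<and> (\<forall>x\<in>carrier P. \<tau> (\<psi> x) = \<phi> x) \<and>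
             operator_norm P Y \<psi> = operator_norm P X \<phi>))"

text \<open>HOL cannot quantify over types inside a formula, so the types of the test spaces have to be
  fixed.  The choice below loses nothing: by theorem \<open>metrically_projective_imp_wrt\<close> at the end of
  this theory, the lifting property for it implies the one for test spaces of arbitrary types.\<close>

definition metrically_projective :: "'p normed_module \<Rightarrow> bool" where
  "metrically_projective P \<longleftrightarrow>
     metrically_projective_wrt TYPE('p \<Rightarrow> complex) TYPE('p) P"

section \<open>The spaces $l_1(M)$ and $l_1^0(M)$\<close>

text \<open>Functions on \<open>M\<close> are represented by functions on the whole type that vanish outside \<open>M\<close>.\<close>

definition l1_space :: "'m set \<Rightarrow> ('m \<Rightarrow> complex) normed_module" where
  "l1_space M =
     \<lparr>carrier = {f. (\<forall>m. m \<notin> M \<longrightarrow> f m = 0) \<and> (\<lambda>m. norm (f m)) summable_on M},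
      mult = undefined, one = undefined,
      zero = (\<lambda>m. 0), add = (\<lambda>f g m. f m + g m),
      smult = (\<lambda>c f m. c * f m),
      nrm = (\<lambda>f. \<Sum>\<^sub>\<infinity>m\<in>M. norm (f m))\<rparr>"

definition l1_0_space :: "'m set \<Rightarrow> ('m \<Rightarrow> complex) normed_module" where
  "l1_0_space M = (l1_space M)\<lparr>carrier := {f \<in> carrier (l1_space M). finite {m. f m \<noteq> 0}}\<rparr>"

section \<open>Basic facts\<close>

lemma complex_ring_simps [simp]:
  "carrier complex_ring = UNIV" "\<one>\<^bsub>complex_ring\<^esub> = 1" "\<zero>\<^bsub>complex_ring\<^esub> = 0"
  "a \<oplus>\<^bsub>complex_ring\<^esub> b = a + b" "a \<otimes>\<^bsub>complex_ring\<^esub> b = a * b"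
  by (simp_all add: complex_ring_def)

lemma cring_complex_ring: "cring complex_ring"
proof (rule cringI)
  show "abelian_group complex_ring"
    by (rule abelian_groupI)
       (auto simp: complex_ring_def add_ac intro: exI[of _ "- x" for x])
  show "comm_monoid complex_ring"
    by (rule comm_monoidI) (auto simp: complex_ring_def)
qed (auto simp: complex_ring_def algebra_simps)

lemma summable_on_norm_add:
  fixes f g :: "'m \<Rightarrow> complex"
  assumes "(\<lambda>m. norm (f m)) summable_on M" "(\<lambda>m. norm (g m)) summable_on M"
  shows "(\<lambda>m. norm (f m + g m)) summable_on M"
  by (rule summable_on_comparison_test[OF summable_on_add[OF assms]])
     (auto intro: norm_triangle_ineq)

lemma complex_normed_space_l1: "complex_normed_space (l1_space M)"
proof -
  have "abelian_group (l1_space M)"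
  proof (rule abelian_groupI)
    fix x assume x: "x \<in> carrier (l1_space M)"
    show "\<exists>y\<in>carrier (l1_space M). y \<oplus>\<^bsub>l1_space M\<^esub> x = \<zero>\<^bsub>l1_space M\<^esub>"
      using x by (intro bexI[of _ "\<lambda>m. - x m"]) (auto simp: l1_space_def)
  qed (auto simp: l1_space_def summable_on_norm_add add_ac)
  then have "module complex_ring (l1_space M)"
    by (intro moduleI cring_complex_ring)
       (auto simp: l1_space_def algebra_simps norm_mult intro: summable_on_cmult_right)
  then show ?thesis
  proof (intro complex_normed_space.intro complex_normed_space_axioms.intro)
    fix x y :: "'a \<Rightarrow> complex" and c
    assume x: "x \<in> carrier (l1_space M)"
    then have sx: "(\<lambda>m. norm (x m)) summable_on M"
      by (simp add: l1_space_def)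
    show "(nrm (l1_space M) x = 0) = (x = \<zero>\<^bsub>l1_space M\<^esub>)"
    proof
      assume "nrm (l1_space M) x = 0"
      then have "(\<Sum>\<^sub>\<infinity>m\<in>M. norm (x m)) \<le> 0" by (simp add: l1_space_def)
      then have "norm (x m) = 0" if "m \<in> M" for m
        by (rule nonneg_infsum_le_0D[OF _ sx]) (use that in auto)
      with x show "x = \<zero>\<^bsub>l1_space M\<^esub>"
        by (auto simp: l1_space_def fun_eq_iff)
    qed (simp add: l1_space_def)
    show "nrm (l1_space M) (c \<odot>\<^bsub>l1_space M\<^esub> x) = norm c * nrm (l1_space M) x"
      using sx by (simp add: l1_space_def norm_mult infsum_cmult_right)
    assume y: "y \<in> carrier (l1_space M)"
    then have sy: "(\<lambda>m. norm (y m)) summable_on M"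
      by (simp add: l1_space_def)
    have "(\<Sum>\<^sub>\<infinity>m\<in>M. norm (x m + y m)) \<le> (\<Sum>\<^sub>\<infinity>m\<in>M. norm (x m) + norm (y m))"
      by (intro infsum_mono summable_on_norm_add summable_on_add sx sy norm_triangle_ineq)
    then show "nrm (l1_space M) (x \<oplus>\<^bsub>l1_space M\<^esub> y) \<le> nrm (l1_space M) x + nrm (l1_space M) y"
      using infsum_add[OF sx sy] by (simp add: l1_space_def)
  qed
qed

lemma l1_0_carrier: "carrier (l1_0_space M) = {f. finite {m. f m \<noteq> 0} \<and> {m. f m \<noteq> 0} \<subseteq> M}"
proof -
  have "(\<lambda>m. norm (f m)) summable_on M" if "finite {m. f m \<noteq> 0}" for f :: "'a \<Rightarrow> complex"
    by (rule finite_nonzero_values_imp_summable_on) (rule finite_subset[OF _ that], auto)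
  then show ?thesis
    by (auto simp: l1_0_space_def l1_space_def)
qed

lemma l1_0_simps [simp]:
  "\<zero>\<^bsub>l1_0_space M\<^esub> = (\<lambda>m. 0)" "f \<oplus>\<^bsub>l1_0_space M\<^esub> g = (\<lambda>m. f m + g m)"
  "c \<odot>\<^bsub>l1_0_space M\<^esub> f = (\<lambda>m. c * f m)"
  by (simp_all add: l1_0_space_def l1_space_def)

lemma l1_0_nrm:
  assumes "finite A" "{m. f m \<noteq> 0} \<subseteq> A" "A \<subseteq> M"
  shows "nrm (l1_0_space M) f = (\<Sum>m\<in>A. norm (f m))"
proof -
  have "(\<Sum>\<^sub>\<infinity>m\<in>M. norm (f m)) = (\<Sum>\<^sub>\<infinity>m\<in>A. norm (f m))"
    by (rule infsum_cong_neutral) (use assms in auto)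
  then show ?thesis
    using assms by (simp add: l1_0_space_def l1_space_def)
qed

lemma complex_normed_space_l1_0: "complex_normed_space (l1_0_space M)"
proof -
  interpret L: complex_normed_space "l1_space M" by (rule complex_normed_space_l1)
  define H where "H = carrier (l1_0_space M)"
  have eq: "l1_0_space M = (l1_space M)\<lparr>carrier := H\<rparr>"
    by (simp add: H_def l1_0_space_def)
  have sub: "H \<subseteq> carrier (l1_space M)"
    by (auto simp: H_def l1_0_space_def)
  have "abelian_group (l1_0_space M)"
  proof (rule abelian_groupI)
    fix x assume x: "x \<in> carrier (l1_0_space M)"
    show "\<exists>y\<in>carrier (l1_0_space M). y \<oplus>\<^bsub>l1_0_space M\<^esub> x = \<zero>\<^bsub>l1_0_space M\<^esub>"
      using x by (intro bexI[of _ "\<lambda>m. - x m"]) (auto simp: l1_0_carrier)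
  next
    fix x y assume xy: "x \<in> carrier (l1_0_space M)" "y \<in> carrier (l1_0_space M)"
    have sub: "{m. x m + y m \<noteq> 0} \<subseteq> {m. x m \<noteq> 0} \<union> {m. y m \<noteq> 0}"
      by auto
    then have "finite {m. x m + y m \<noteq> 0}"
      by (rule finite_subset) (use xy in \<open>simp add: l1_0_carrier\<close>)
    moreover have "{m. x m + y m \<noteq> 0} \<subseteq> M"
      using sub xy by (force simp: l1_0_carrier)
    ultimately show "x \<oplus>\<^bsub>l1_0_space M\<^esub> y \<in> carrier (l1_0_space M)"
      by (simp add: l1_0_carrier)
  qed (auto simp: l1_0_carrier add_ac)
  moreover have "c \<odot>\<^bsub>l1_0_space M\<^esub> x \<in> carrier (l1_0_space M)"
    if "x \<in> carrier (l1_0_space M)" for c x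
  proof -
    have "finite {m. c * x m \<noteq> 0}"
      by (rule finite_subset[of _ "{m. x m \<noteq> 0}"]) (use that in \<open>auto simp: l1_0_carrier\<close>)
    with that show ?thesis by (auto simp: l1_0_carrier)
  qed
  ultimately have "module complex_ring (l1_0_space M)"
    by (intro moduleI cring_complex_ring) (simp_all add: algebra_simps)
  then show ?thesis
  proof (intro complex_normed_space.intro complex_normed_space_axioms.intro)
    fix x y assume "x \<in> carrier (l1_0_space M)" "y \<in> carrier (l1_0_space M)"
    then show "nrm (l1_0_space M) (x \<oplus>\<^bsub>l1_0_space M\<^esub> y) \<le> nrm (l1_0_space M) x + nrm (l1_0_space M) y"
      using L.nrm_triangle[of x y] sub unfolding H_def[symmetric]
      by (auto simp: eq)
  next
    fix x assume "x \<in> carrier (l1_0_space M)"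
    then show "nrm (l1_0_space M) x = 0 \<longleftrightarrow> x = \<zero>\<^bsub>l1_0_space M\<^esub>"
      using L.nrm_eq_zero_iff[of x] sub unfolding H_def[symmetric] by (auto simp: eq)
  next
    fix x c assume "x \<in> carrier (l1_0_space M)"
    then show "nrm (l1_0_space M) (c \<odot>\<^bsub>l1_0_space M\<^esub> x) = norm c * nrm (l1_0_space M) x"
      using L.nrm_smult[of x c] sub unfolding H_def[symmetric] by (auto simp: eq)
  qed
qed

context complex_normed_space
begin

lemma smult_in_carrier: "x \<in> carrier V \<Longrightarrow> c \<odot> x \<in> carrier V"
  by simp

lemma nrm_zero [simp]: "nrm V \<zero> = 0"
  by (simp add: nrm_eq_zero_iff)

lemma nrm_nonneg:
  assumes x: "x \<in> carrier V" shows "0 \<le> nrm V x"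
proof -
  have "x \<oplus> (-1) \<odot> x = (1 + (-1)) \<odot> x"
    using smult_l_distr[of 1 "-1" x] smult_one[OF x] x by simp
  also have "\<dots> = \<zero>"
    using smult_l_null[OF x] by simp
  finally have "0 = nrm V (x \<oplus> (-1) \<odot> x)" by simp
  also have "\<dots> \<le> nrm V x + nrm V ((-1) \<odot> x)"
    by (rule nrm_triangle[OF x smult_in_carrier[OF x]])
  also have "\<dots> = 2 * nrm V x"
    using nrm_smult[OF x, of "-1"] by simp
  finally show ?thesis by simp
qed

lemma nrm_finsum:
  assumes "finite A" "h \<in> A \<rightarrow> carrier V"
  shows "nrm V (finsum V h A) \<le> (\<Sum>a\<in>A. nrm V (h a))"
  using assms
proof (induction A rule: finite_induct)
  case (insert a A)
  then have "nrm V (finsum V h (insert a A)) \<le> nrm V (h a) + nrm V (finsum V h A)"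
    by (simp add: Pi_def nrm_triangle)
  with insert show ?case by (simp add: Pi_def)
qed simp

text \<open>The linear extension of a family of vectors to $l_1^0(M)$.\<close>

definition ext :: "('m \<Rightarrow> 'a) \<Rightarrow> ('m \<Rightarrow> complex) \<Rightarrow> 'a" where
  "ext v f = (\<Oplus>m\<in>{m. f m \<noteq> 0}. f m \<odot> v m)"

lemma ext_eq:
  assumes v: "v \<in> M \<rightarrow> carrier V" and A: "finite A" "{m. f m \<noteq> 0} \<subseteq> A" "A \<subseteq> M"
  shows "ext v f = (\<Oplus>m\<in>A. f m \<odot> v m)"
  unfolding ext_def
proof (rule add.finprod_mono_neutral_cong_left[OF A(1,2)])
  show "f i \<odot> v i = \<zero>" if "i \<in> A - {m. f m \<noteq> 0}" for i
  proof -
    from that have "v i \<in> carrier V" "f i = 0" using v A(3) by auto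
    then show ?thesis using smult_l_null[of "v i"] by simp
  qed
  show "(\<lambda>m. f m \<odot> v m) \<in> A \<rightarrow> carrier V"
    using v A(3) by (auto intro!: smult_in_carrier)
qed auto

lemma ext_linear:
  assumes v: "v \<in> M \<rightarrow> carrier V"
  shows "linear_operator (l1_0_space M) V (ext v)"
  unfolding linear_operator_def
proof (intro conjI ballI allI funcsetI)
  fix f assume f: "f \<in> carrier (l1_0_space M)"
  have vc: "v m \<in> carrier V" if "m \<in> M" for m
    using v that by auto
  from f show "ext v f \<in> carrier V"
    unfolding ext_def using v by (intro finsum_closed) (auto simp: l1_0_carrier Pi_def)
  fix c
  let ?A = "{m. f m \<noteq> 0}"
  have A: "finite ?A" "?A \<subseteq> M" using f by (auto simp: l1_0_carrier)
  have "c \<odot> ext v f = (\<Oplus>m\<in>?A. c \<odot> (f m \<odot> v m))"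
    unfolding ext_def using A v by (intro finsum_smult_ldistr) (auto intro!: smult_in_carrier)
  also have "\<dots> = (\<Oplus>m\<in>?A. (c * f m) \<odot> v m)"
  proof (rule finsum_cong')
    fix m assume "m \<in> ?A"
    then show "c \<odot> (f m \<odot> v m) = (c * f m) \<odot> v m"
      using A vc[of m] smult_assoc1[of c "f m" "v m"] by auto
  qed (use A vc in \<open>auto intro!: smult_in_carrier\<close>)
  also have "\<dots> = ext v (c \<odot>\<^bsub>l1_0_space M\<^esub> f)"
    unfolding l1_0_simps by (rule ext_eq[OF v, symmetric]) (use A in auto)
  finally show "ext v (c \<odot>\<^bsub>l1_0_space M\<^esub> f) = c \<odot> ext v f" ..
next
  fix f g assume f: "f \<in> carrier (l1_0_space M)" and g: "g \<in> carrier (l1_0_space M)"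
  let ?A = "{m. f m \<noteq> 0} \<union> {m. g m \<noteq> 0}"
  have A: "finite ?A" "?A \<subseteq> M" using f g by (auto simp: l1_0_carrier)
  have "ext v (f \<oplus>\<^bsub>l1_0_space M\<^esub> g) = (\<Oplus>m\<in>?A. (f m + g m) \<odot> v m)"
    unfolding l1_0_simps by (rule ext_eq[OF v]) (use A in auto)
  also have "\<dots> = (\<Oplus>m\<in>?A. f m \<odot> v m \<oplus> g m \<odot> v m)"
  proof (rule finsum_cong')
    fix m assume "m \<in> ?A"
    then have "v m \<in> carrier V" using A v by blast
    then show "(f m + g m) \<odot> v m = f m \<odot> v m \<oplus> g m \<odot> v m"
      using smult_l_distr[of "f m" "g m" "v m"] by simp
  qed (use A v in \<open>auto intro!: a_closed smult_in_carrier\<close>)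
  also have "\<dots> = (\<Oplus>m\<in>?A. f m \<odot> v m) \<oplus> (\<Oplus>m\<in>?A. g m \<odot> v m)"
    using A v by (intro finsum_addf) (auto intro!: smult_in_carrier)
  also have "\<dots> = ext v f \<oplus> ext v g"
    using ext_eq[OF v A(1) _ A(2), of f] ext_eq[OF v A(1) _ A(2), of g] by simp
  finally show "ext v (f \<oplus>\<^bsub>l1_0_space M\<^esub> g) = ext v f \<oplus> ext v g" .
qed

lemma ext_nrm:
  assumes v: "v \<in> M \<rightarrow> carrier V" and c: "\<And>m. m \<in> M \<Longrightarrow> nrm V (v m) \<le> c"
    and f: "f \<in> carrier (l1_0_space M)"
  shows "nrm V (ext v f) \<le> c * nrm (l1_0_space M) f"
proof -
  let ?A = "{m. f m \<noteq> 0}"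
  have A: "finite ?A" "?A \<subseteq> M" using f by (auto simp: l1_0_carrier)
  have "nrm V (ext v f) \<le> (\<Sum>m\<in>?A. nrm V (f m \<odot> v m))"
    unfolding ext_def by (rule nrm_finsum) (use A v in \<open>auto intro!: smult_in_carrier\<close>)
  also have "\<dots> = (\<Sum>m\<in>?A. norm (f m) * nrm V (v m))"
    using A v by (intro sum.cong refl nrm_smult) auto
  also have "\<dots> \<le> (\<Sum>m\<in>?A. norm (f m) * c)"
    using A c by (intro sum_mono mult_left_mono) auto
  also have "\<dots> = c * nrm (l1_0_space M) f"
    using l1_0_nrm[OF A(1) order_refl A(2)] by (simp add: sum_distrib_left mult_ac)
  finally show ?thesis .
qed

lemma ext_unit:
  assumes v: "v \<in> M \<rightarrow> carrier V" and m: "m \<in> M"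
  shows "ext v (\<lambda>k. if k = m then 1 else 0) = v m"
proof -
  have "v m \<in> carrier V" using assms by auto
  then show ?thesis
    using ext_eq[OF v, of "{m}" "\<lambda>k. if k = m then 1 else 0"] m smult_one[of "v m"]
    by simp
qed

end

lemma linear_operator_zero:
  assumes "complex_normed_space V" "complex_normed_space W" "linear_operator V W T"
  shows "T \<zero>\<^bsub>V\<^esub> = \<zero>\<^bsub>W\<^esub>"
proof -
  interpret V: complex_normed_space V by fact
  interpret W: complex_normed_space W by fact
  have "T \<zero>\<^bsub>V\<^esub> = T (0 \<odot>\<^bsub>V\<^esub> \<zero>\<^bsub>V\<^esub>)"
    using V.smult_r_null[of 0] by simp
  also have "\<dots> = 0 \<odot>\<^bsub>W\<^esub> T \<zero>\<^bsub>V\<^esub>"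
    using assms(3) V.zero_closed unfolding linear_operator_def by blast
  also have "\<dots> = \<zero>\<^bsub>W\<^esub>"
    using W.smult_l_null[of "T \<zero>\<^bsub>V\<^esub>"] assms(3) by (auto simp: linear_operator_def)
  finally show ?thesis .
qed

text \<open>The operator norm is the least bound.\<close>

lemma operator_norm_bound:
  assumes V: "complex_normed_space V" and W: "complex_normed_space W"
    and T: "bounded_operator V W T"
  shows "0 \<le> operator_norm V W T"
    and "x \<in> carrier V \<Longrightarrow> nrm W (T x) \<le> operator_norm V W T * nrm V x"
proof -
  interpret V: complex_normed_space V by fact
  interpret W: complex_normed_space W by fact
  have lin: "linear_operator V W T" using T by (simp add: bounded_operator_def)
  obtain K where K: "\<And>x. x \<in> carrier V \<Longrightarrow> nrm W (T x) \<le> K * nrm V x"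
    using T by (auto simp: bounded_operator_def)
  have bdd: "bdd_above ((\<lambda>x. nrm W (T x)) ` unit_ball V)"
  proof (rule bdd_aboveI2)
    fix x assume "x \<in> unit_ball V"
    then have x: "x \<in> carrier V" "nrm V x \<le> 1" by (auto simp: unit_ball_def)
    have "nrm W (T x) \<le> K * nrm V x" by (rule K[OF x(1)])
    also have "\<dots> \<le> \<bar>K\<bar> * nrm V x"
      by (intro mult_right_mono V.nrm_nonneg x) auto
    also have "\<dots> \<le> \<bar>K\<bar> * 1"
      by (intro mult_left_mono x) auto
    finally show "nrm W (T x) \<le> \<bar>K\<bar>" by simp
  qed
  then have ball: "nrm W (T x) \<le> operator_norm V W T" if "x \<in> unit_ball V" for x
    unfolding operator_norm_def using that by (intro cSUP_upper)
  have "nrm W (T \<zero>\<^bsub>V\<^esub>) \<le> operator_norm V W T"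
    by (rule ball) (simp add: unit_ball_def)
  then show nn: "0 \<le> operator_norm V W T"
    by (simp add: linear_operator_zero[OF V W lin])
  assume x: "x \<in> carrier V"
  show "nrm W (T x) \<le> operator_norm V W T * nrm V x"
  proof (cases "nrm V x = 0")
    case True
    then have "x = \<zero>\<^bsub>V\<^esub>" using V.nrm_eq_zero_iff[OF x] by simp
    then show ?thesis by (simp add: linear_operator_zero[OF V W lin])
  next
    case False
    then have pos: "nrm V x > 0" using V.nrm_nonneg[OF x] by simp
    define c where "c = complex_of_real (1 / nrm V x)"
    have nc: "norm c = 1 / nrm V x" using pos by (simp add: c_def norm_divide)
    have "c \<odot>\<^bsub>V\<^esub> x \<in> unit_ball V"
      using V.nrm_smult[OF x, of c] V.smult_in_carrier[OF x] nc pos by (simp add: unit_ball_def)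
    then have "nrm W (T (c \<odot>\<^bsub>V\<^esub> x)) \<le> operator_norm V W T" by (rule ball)
    moreover have "T (c \<odot>\<^bsub>V\<^esub> x) = c \<odot>\<^bsub>W\<^esub> T x" and "T x \<in> carrier W"
      using lin x by (auto simp: linear_operator_def)
    ultimately have "norm c * nrm W (T x) \<le> operator_norm V W T"
      using W.nrm_smult[of "T x" c] by simp
    then show ?thesis using pos nc by (simp add: field_simps)
  qed
qed

lemma operator_norm_le:
  assumes V: "complex_normed_space V" and "0 \<le> c"
    and c: "\<And>x. x \<in> carrier V \<Longrightarrow> nrm W (T x) \<le> c * nrm V x"
  shows "operator_norm V W T \<le> c"
  unfolding operator_norm_def
proof (rule cSUP_least)
  interpret V: complex_normed_space V by fact
  show "unit_ball V \<noteq> {}" by (auto simp: unit_ball_def intro!: exI[of _ "\<zero>\<^bsub>V\<^esub>"])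
  fix x assume "x \<in> unit_ball V"
  then have x: "x \<in> carrier V" "nrm V x \<le> 1" by (auto simp: unit_ball_def)
  have "nrm W (T x) \<le> c * nrm V x" by (rule c[OF x(1)])
  also have "\<dots> \<le> c * 1" using assms(2) x by (intro mult_left_mono)
  finally show "nrm W (T x) \<le> c" by simp
qed

section \<open>Independence of the types of the test spaces\<close>

text \<open>The lifting property is only used for the canonical operator from $l_1^0$ of the unit ball of
  \<open>P\<close> onto \<open>P\<close> and the identity of \<open>P\<close>.\<close>

theorem metrically_projective_imp_wrt:
  fixes P :: "'p normed_module"
  assumes P: "complex_normed_space P" and proj: "metrically_projective P"
  shows "metrically_projective_wrt TYPE('y) TYPE('x) P"
proof -
  interpret P: complex_normed_space P by fact
  define B where "B = unit_ball P"
  define L where "L = l1_0_space B"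
  have Lns: "complex_normed_space L" unfolding L_def by (rule complex_normed_space_l1_0)
  interpret L: complex_normed_space L by fact
  have B: "(\<lambda>b. b) \<in> B \<rightarrow> carrier P" "\<And>b. b \<in> B \<Longrightarrow> nrm P b \<le> 1"
    by (auto simp: B_def unit_ball_def)
  let ?\<pi> = "P.ext (\<lambda>b. b)"
  have lin_pi: "linear_operator L P ?\<pi>" unfolding L_def by (rule P.ext_linear[OF B(1)])
  have nrm_pi: "nrm P (?\<pi> f) \<le> 1 * nrm L f" if "f \<in> carrier L" for f
    using that unfolding L_def by (intro P.ext_nrm[OF B])
  have "?\<pi> ` unit_ball L = unit_ball P"
  proof (intro equalityI subsetI)
    fix x assume "x \<in> ?\<pi> ` unit_ball L"
    then show "x \<in> unit_ball P"
      using lin_pi nrm_pi by (force simp: unit_ball_def linear_operator_def Pi_def)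
  next
    fix x assume "x \<in> unit_ball P"
    then have x: "x \<in> B" by (simp add: B_def)
    let ?d = "\<lambda>k. if k = x then 1 else 0 :: complex"
    have "?d \<in> carrier L" using x by (auto simp: L_def l1_0_carrier)
    moreover have "nrm L ?d = 1"
      using l1_0_nrm[of "{x}" ?d B] x by (simp add: L_def)
    moreover have "?\<pi> ?d = x" by (rule P.ext_unit[OF B(1) x])
    ultimately show "x \<in> ?\<pi> ` unit_ball L" by (force simp: unit_ball_def image_iff)
  qed
  then have cois: "strictly_coisometric L P ?\<pi>" by (simp add: strictly_coisometric_def)
  have bdd_id: "bounded_operator P P (\<lambda>x. x)"
    by (auto simp: bounded_operator_def linear_operator_def intro!: exI[of _ 1])
  obtain \<sigma> where sig: "bounded_operator P L \<sigma>" "\<And>x. x \<in> carrier P \<Longrightarrow> ?\<pi> (\<sigma> x) = x"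
    "operator_norm P L \<sigma> = operator_norm P P (\<lambda>x. x)"
    using proj Lns P lin_pi cois bdd_id
    unfolding metrically_projective_def metrically_projective_wrt_def by blast
  have sig1: "operator_norm P L \<sigma> \<le> 1"
    unfolding sig(3) by (rule operator_norm_le[OF P]) auto
  have sig_lin: "linear_operator P L \<sigma>" using sig(1) by (simp add: bounded_operator_def)
  have sig_nrm: "nrm L (\<sigma> x) \<le> nrm P x" if x: "x \<in> carrier P" for x
  proof -
    have "nrm L (\<sigma> x) \<le> operator_norm P L \<sigma> * nrm P x"
      by (rule operator_norm_bound(2)[OF P Lns sig(1) x])
    also have "\<dots> \<le> 1 * nrm P x" by (intro mult_right_mono sig1 P.nrm_nonneg x)
    finally show ?thesis by simp
  qed
  show ?thesis
    unfolding metrically_projective_wrt_def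
  proof (intro allI impI)
    fix Y :: "'y normed_module" and X :: "'x normed_module" and \<tau> \<phi>
    assume Y: "complex_normed_space Y" and X: "complex_normed_space X"
      and tau: "linear_operator Y X \<tau>" "strictly_coisometric Y X \<tau>"
      and phi: "bounded_operator P X \<phi>"
    interpret Y: complex_normed_space Y by fact
    interpret X: complex_normed_space X by fact
    define c where "c = operator_norm P X \<phi>"
    have c0: "0 \<le> c" unfolding c_def by (rule operator_norm_bound(1)[OF P X phi])
    have phi_lin: "linear_operator P X \<phi>" using phi by (simp add: bounded_operator_def)
    have phi_c: "nrm X (\<phi> x) \<le> c * nrm P x" if "x \<in> carrier P" for x
      unfolding c_def by (rule operator_norm_bound(2)[OF P X phi that])
    have "\<exists>y. y \<in> carrier Y \<and> nrm Y y \<le> c \<and> \<tau> y = \<phi> b" if b: "b \<in> B" for b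
    proof -
      have b': "b \<in> carrier P" "nrm P b \<le> 1" using b by (auto simp: B_def unit_ball_def)
      have pb: "\<phi> b \<in> carrier X" using phi_lin b' by (auto simp: linear_operator_def)
      have "c * nrm P b \<le> c * 1" by (intro mult_left_mono c0 b')
      then have nb: "nrm X (\<phi> b) \<le> c" using phi_c[OF b'(1)] by simp
      show ?thesis
      proof (cases "c = 0")
        case True
        then have "\<phi> b = \<zero>\<^bsub>X\<^esub>"
          using nb X.nrm_nonneg[OF pb] X.nrm_eq_zero_iff[OF pb] by simp
        then show ?thesis
          using True linear_operator_zero[OF Y X tau(1)] by (intro exI[of _ "\<zero>\<^bsub>Y\<^esub>"]) simp
      next
        case False
        then have cpos: "c > 0" using c0 by simp
        define r where "r = complex_of_real c"
        have r: "r \<noteq> 0" "norm r = c" using cpos by (auto simp: r_def)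
        have "nrm X (inverse r \<odot>\<^bsub>X\<^esub> \<phi> b) \<le> 1"
          unfolding X.nrm_smult[OF pb] norm_inverse r(2) using nb cpos by (simp add: field_simps)
        then have "inverse r \<odot>\<^bsub>X\<^esub> \<phi> b \<in> unit_ball X"
          using X.smult_in_carrier[OF pb] by (simp add: unit_ball_def)
        then obtain y where y: "y \<in> unit_ball Y" "inverse r \<odot>\<^bsub>X\<^esub> \<phi> b = \<tau> y"
          using tau(2) unfolding strictly_coisometric_def by blast
        then have yc: "y \<in> carrier Y" "nrm Y y \<le> 1" by (auto simp: unit_ball_def)
        have "\<tau> (r \<odot>\<^bsub>Y\<^esub> y) = r \<odot>\<^bsub>X\<^esub> (inverse r \<odot>\<^bsub>X\<^esub> \<phi> b)"
          using tau(1) yc y(2) by (simp add: linear_operator_def)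
        also have "\<dots> = (r * inverse r) \<odot>\<^bsub>X\<^esub> \<phi> b"
          using X.smult_assoc1[of r "inverse r" "\<phi> b"] pb by simp
        also have "\<dots> = \<phi> b" using r X.smult_one[OF pb] by simp
        finally show ?thesis
          using Y.nrm_smult[OF yc(1), of r] Y.smult_in_carrier[OF yc(1), of r] yc r c0
          by (intro exI[of _ "r \<odot>\<^bsub>Y\<^esub> y"]) (simp add: mult_left_le)
      qed
    qed
    then obtain v where v: "\<And>b. b \<in> B \<Longrightarrow> v b \<in> carrier Y \<and> nrm Y (v b) \<le> c \<and> \<tau> (v b) = \<phi> b"
      by metis
    have vB: "v \<in> B \<rightarrow> carrier Y" using v by auto
    have ext_lin: "linear_operator L Y (Y.ext v)" unfolding L_def by (rule Y.ext_linear[OF vB])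
    have tau_fin: "\<tau> (finsum Y h A) = finsum X (\<lambda>a. \<tau> (h a)) A"
      if "finite A" "h \<in> A \<rightarrow> carrier Y" for h and A :: "'p set"
      using that tau(1)
      by (induction A rule: finite_induct)
         (auto simp: linear_operator_def linear_operator_zero[OF Y X tau(1)] Pi_def)
    have phi_fin: "\<phi> (finsum P h A) = finsum X (\<lambda>a. \<phi> (h a)) A"
      if "finite A" "h \<in> A \<rightarrow> carrier P" for h and A :: "'p set"
      using that phi_lin
      by (induction A rule: finite_induct)
         (auto simp: linear_operator_def linear_operator_zero[OF P X phi_lin] Pi_def)
    have tau_ext: "\<tau> (Y.ext v f) = \<phi> (?\<pi> f)" if f: "f \<in> carrier L" for f
    proof -
      let ?A = "{m. f m \<noteq> 0}"
      have A: "finite ?A" "?A \<subseteq> B" using f by (auto simp: L_def l1_0_carrier)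
      have BP: "b \<in> carrier P" if "b \<in> B" for b using B(1) that by auto
      have "\<tau> (Y.ext v f) = finsum X (\<lambda>m. \<tau> (f m \<odot>\<^bsub>Y\<^esub> v m)) ?A"
        unfolding Y.ext_def using A v by (intro tau_fin) auto
      also have "\<dots> = finsum X (\<lambda>m. \<phi> (f m \<odot>\<^bsub>P\<^esub> m)) ?A"
      proof (rule X.finsum_cong')
        show "(\<lambda>m. \<phi> (f m \<odot>\<^bsub>P\<^esub> m)) \<in> ?A \<rightarrow> carrier X"
          using phi_lin A BP P.smult_in_carrier by (auto simp: linear_operator_def Pi_def)
        fix m assume "m \<in> ?A"
        then have m: "m \<in> B" using A by auto
        then show "\<tau> (f m \<odot>\<^bsub>Y\<^esub> v m) = \<phi> (f m \<odot>\<^bsub>P\<^esub> m)"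
          using tau(1) phi_lin v[OF m] BP[OF m] by (simp add: linear_operator_def)
      qed simp
      also have "\<dots> = \<phi> (?\<pi> f)"
        unfolding P.ext_def using A BP by (intro phi_fin[symmetric]) auto
      finally show ?thesis .
    qed
    define \<psi> where "\<psi> x = Y.ext v (\<sigma> x)" for x
    have sigL: "\<sigma> x \<in> carrier L" if "x \<in> carrier P" for x
      using sig_lin that by (auto simp: linear_operator_def)
    have psi_c: "nrm Y (\<psi> x) \<le> c * nrm P x" if x: "x \<in> carrier P" for x
    proof -
      have "nrm Y (\<psi> x) \<le> c * nrm L (\<sigma> x)"
        using v sigL[OF x] unfolding \<psi>_def L_def by (intro Y.ext_nrm[OF vB]) auto
      also have "\<dots> \<le> c * nrm P x" by (intro mult_left_mono sig_nrm x c0)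
      finally show ?thesis .
    qed
    have "linear_operator P Y \<psi>"
      using sig_lin ext_lin unfolding linear_operator_def \<psi>_def by (auto simp: Pi_def)
    then have psi: "bounded_operator P Y \<psi>" using psi_c by (auto simp: bounded_operator_def)
    have lift: "\<tau> (\<psi> x) = \<phi> x" if "x \<in> carrier P" for x
      using tau_ext[OF sigL[OF that]] sig(2)[OF that] by (simp add: \<psi>_def)
    have tau_le: "nrm X (\<tau> y) \<le> 1" if "y \<in> unit_ball Y" for y
      using tau(2) that unfolding strictly_coisometric_def by (auto simp: unit_ball_def)
    have tau_bdd: "bounded_operator Y X \<tau>"
      unfolding bounded_operator_def
    proof (intro conjI exI ballI)
      fix y assume y: "y \<in> carrier Y"
      show "nrm X (\<tau> y) \<le> 1 * nrm Y y"
      proof (cases "nrm Y y = 0")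
        case True
        then have "y = \<zero>\<^bsub>Y\<^esub>" using Y.nrm_eq_zero_iff[OF y] by simp
        then show ?thesis by (simp add: linear_operator_zero[OF Y X tau(1)])
      next
        case False
        then have pos: "nrm Y y > 0" using Y.nrm_nonneg[OF y] by simp
        define k where "k = complex_of_real (1 / nrm Y y)"
        have nk: "norm k = 1 / nrm Y y" using pos by (simp add: k_def norm_divide)
        have "k \<odot>\<^bsub>Y\<^esub> y \<in> unit_ball Y"
          using Y.nrm_smult[OF y, of k] Y.smult_in_carrier[OF y] nk pos by (simp add: unit_ball_def)
        then have "nrm X (\<tau> (k \<odot>\<^bsub>Y\<^esub> y)) \<le> 1" by (rule tau_le)
        moreover have "\<tau> (k \<odot>\<^bsub>Y\<^esub> y) = k \<odot>\<^bsub>X\<^esub> \<tau> y" and "\<tau> y \<in> carrier X"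
          using tau(1) y by (auto simp: linear_operator_def)
        ultimately have "norm k * nrm X (\<tau> y) \<le> 1" using X.nrm_smult[of "\<tau> y" k] by simp
        then show ?thesis using pos nk by (simp add: field_simps)
      qed
    qed (rule tau(1))
    have tau_contr: "nrm X (\<tau> y) \<le> nrm Y y" if y: "y \<in> carrier Y" for y
    proof -
      have "operator_norm Y X \<tau> \<le> 1"
        unfolding operator_norm_def
        by (rule cSUP_least) (auto simp: unit_ball_def intro!: tau_le exI[of _ "\<zero>\<^bsub>Y\<^esub>"])
      then have "operator_norm Y X \<tau> * nrm Y y \<le> 1 * nrm Y y"
        by (intro mult_right_mono Y.nrm_nonneg y)
      then show ?thesis using operator_norm_bound(2)[OF Y X tau_bdd y] by simp
    qed
    have "operator_norm P Y \<psi> \<le> c" by (rule operator_norm_le[OF P c0 psi_c])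
    moreover have "c \<le> operator_norm P Y \<psi>"
      unfolding c_def
    proof (rule operator_norm_le[OF P operator_norm_bound(1)[OF P Y psi]])
      fix x assume x: "x \<in> carrier P"
      have "\<psi> x \<in> carrier Y" using psi x by (auto simp: bounded_operator_def linear_operator_def)
      then have "nrm X (\<phi> x) \<le> nrm Y (\<psi> x)" using tau_contr lift[OF x] by metis
      also have "\<dots> \<le> operator_norm P Y \<psi> * nrm P x"
        by (rule operator_norm_bound(2)[OF P Y psi x])
      finally show "nrm X (\<phi> x) \<le> operator_norm P Y \<psi> * nrm P x" .
    qed
    ultimately show "\<exists>\<psi>. bounded_operator P Y \<psi> \<and> (\<forall>x\<in>carrier P. \<tau> (\<psi> x) = \<phi> x) \<and>
             operator_norm P Y \<psi> = operator_norm P X \<phi>"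
      using psi lift unfolding c_def by (intro exI[of _ \<psi>]) auto
  qed
qed

end

theory Submission
  imports Defs
begin

text \<open>Lifting the identity of \<open>P\<close> across the canonical operator from \<open>l\<^sub>1\<^sup>0(B)\<close> onto \<open>P\<close>, where \<open>B\<close>
  is the unit ball, makes \<open>P\<close> the range \<open>F\<close> of a contractive projection of \<open>l\<^sub>1\<^sup>0(B)\<close>.  If
  \<open>k, h \<in> F\<close> and \<open>supp h \<subseteq> supp k\<close>, then equality in the triangle inequality forces
  \<open>sgn k \<cdot> |h| \<in> F\<close>.  So up to the phase of \<open>k\<close> the elements of \<open>F\<close> supported in \<open>supp k\<close> are
  closed under minima of absolute values, and supports of elements of \<open>F\<close> are closed under
  intersection.  Hence minimal nonempty supports are equal or disjoint.  Choosing one normalized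
  vector per minimal support gives \<open>M\<close>: disjointness makes the norm of a combination the
  \<open>l\<^sub>1\<close> norm of its coefficients, and subtracting a multiple of a vector of minimal support from an
  element of \<open>F\<close> shrinks the finite support of the latter, so \<open>M\<close> spans.\<close>

section \<open>Minimal supports in a contractively complemented subspace of $l_1^0$\<close>

text \<open>Equality case of Re (cnj w * z) <= |w| |z|: with both assumptions, expanding the square
  of |z - w |z|| bounds it by |z|^2 - 2 |z|^2 + |z|^2 = 0.\<close>

lemma eq_mult_norm_if_norm_le_Re:
  fixes w z :: complex
  assumes "norm w \<le> 1" "norm z \<le> Re (cnj w * z)"
  shows "z = w * norm z"
proof -
  define n where "n = norm z"
  have n2: "n * n = Re z * Re z + Im z * Im z"
    by (simp add: n_def cmod_def flip: power2_eq_square)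
  have w2: "Re w * Re w + Im w * Im w \<le> 1"
    using power_mono[OF assms(1), of 2] by (simp add: cmod_power2) (simp add: power2_eq_square)
  have "(norm (z - w * n))\<^sup>2
      = (Re z * Re z + Im z * Im z) - 2 * n * Re (cnj w * z) + (Re w * Re w + Im w * Im w) * (n * n)"
    by (simp add: cmod_power2) (simp add: power2_eq_square algebra_simps)
  also have "\<dots> \<le> n * n - 2 * n * n + 1 * (n * n)"
    unfolding n2[symmetric] using assms(2) w2 by (intro add_mono diff_mono mult_right_mono) (auto simp: n_def mult_left_mono)
  finally show ?thesis by (simp add: n_def)
qed

text \<open>Serves coordinatewise for combinations of vectors with disjoint supports, where the
  triangle inequality becomes an equality.\<close>

lemma norm_sum_at_most_one_nonzero:
  fixes g :: "'i \<Rightarrow> 'a::real_normed_vector"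
  assumes "finite A" "\<And>i j. i \<in> A \<Longrightarrow> j \<in> A \<Longrightarrow> g i \<noteq> 0 \<Longrightarrow> g j \<noteq> 0 \<Longrightarrow> i = j"
  shows "norm (\<Sum>i\<in>A. g i) = (\<Sum>i\<in>A. norm (g i))"
proof (cases "\<exists>i\<in>A. g i \<noteq> 0")
  case True
  then obtain i where i: "i \<in> A" "g i \<noteq> 0" by blast
  then have z: "g j = 0" if "j \<in> A - {i}" for j using assms(2)[OF i(1)] that by blast
  show ?thesis using assms(1) i(1) z by (simp add: sum.remove[of A i])
qed simp

section \<open>Supports and the columns of the projection\<close>

definition supp :: "('b \<Rightarrow> complex) \<Rightarrow> 'b set" where
  "supp f = {m. f m \<noteq> 0}"

text \<open>\<open>q s\<close> is the image of the unit vector at \<open>s\<close> under the projection onto \<open>F\<close>.\<close>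

locale contractive_projection_range =
  fixes F :: "('b \<Rightarrow> complex) set" and q :: "'b \<Rightarrow> 'b \<Rightarrow> complex"
  assumes finite_supp: "f \<in> F \<Longrightarrow> finite (supp f)"
    and zero: "(\<lambda>m. 0) \<in> F"
    and add: "f \<in> F \<Longrightarrow> g \<in> F \<Longrightarrow> (\<lambda>m. f m + g m) \<in> F"
    and scale: "f \<in> F \<Longrightarrow> (\<lambda>m. c * f m) \<in> F"
    and column: "f \<in> F \<Longrightarrow> s \<in> supp f \<Longrightarrow> q s \<in> F"
    and contractive: "f \<in> F \<Longrightarrow> s \<in> supp f \<Longrightarrow> (\<Sum>m\<in>supp (q s). norm (q s m)) \<le> 1"
    and reproducing: "f \<in> F \<Longrightarrow> f m = (\<Sum>s\<in>supp f. f s * q s m)"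
begin

lemma combination:
  assumes "finite A" "\<And>a. a \<in> A \<Longrightarrow> f a \<in> F"
  shows "(\<lambda>m. \<Sum>a\<in>A. c a * f a m) \<in> F"
  using assms
proof (induction A rule: finite_induct)
  case (insert a A)
  then have "(\<lambda>m. c a * f a m + (\<Sum>a\<in>A. c a * f a m)) \<in> F"
    by (intro add scale) auto
  with insert show ?case by simp
qed (simp add: zero)

lemma reproducing_on:
  assumes "f \<in> F" "finite A" "supp f \<subseteq> A"
  shows "f m = (\<Sum>s\<in>A. f s * q s m)"
  unfolding reproducing[OF assms(1), of m]
  by (rule sum.mono_neutral_left) (use assms in \<open>auto simp: supp_def\<close>)

lemma column_norm_sum_le:
  assumes "f \<in> F" "s \<in> supp f" "finite A"
  shows "(\<Sum>m\<in>A. norm (q s m)) \<le> 1"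
proof -
  have "(\<Sum>m\<in>A. norm (q s m)) = (\<Sum>m\<in>A \<inter> supp (q s). norm (q s m))"
    using assms(3) by (intro sum.mono_neutral_right) (auto simp: supp_def)
  also have "\<dots> \<le> (\<Sum>m\<in>supp (q s). norm (q s m))"
    by (intro sum_mono2 finite_supp column[OF assms(1,2)]) auto
  also have "\<dots> \<le> 1" by (rule contractive[OF assms(1,2)])
  finally show ?thesis .
qed

text \<open>Reproducing \<open>k\<close> is only possible without loss of norm, so all the columns used must point
  in the direction of \<open>k\<close> at every coordinate; in particular they vanish off \<open>supp k\<close>.\<close>

lemma column_aligned:
  assumes k: "k \<in> F" and s: "s \<in> supp k"
  shows "sgn (k s) * q s m = sgn (k m) * norm (q s m)"
proof -
  \<comment> \<open>The coordinate \<open>m\<close> may lie off \<open>supp k\<close>. There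
    \<open>sgn (k m) = 0\<close>, so the defect \<open>?d s m\<close> is the whole norm of
    \<open>k s * q s m\<close>, and its vanishing says \<open>q s m = 0\<close>.\<close>
  let ?K = "insert m (supp k)"
  let ?d = "\<lambda>s m. norm (k s * q s m) - Re (cnj (sgn (k m)) * (k s * q s m))"
  have fin: "finite ?K" "finite (supp k)" using finite_supp[OF k] by auto
  have d0: "0 \<le> ?d s m" for s m
  proof -
    have "Re (cnj (sgn (k m)) * (k s * q s m)) \<le> norm (cnj (sgn (k m)) * (k s * q s m))"
      by (rule complex_Re_le_cmod)
    also have "\<dots> \<le> 1 * norm (k s * q s m)"
      unfolding norm_mult[of "cnj _"] by (intro mult_right_mono) (auto simp: norm_sgn)
    finally show ?thesis by simp
  qed
  have kn: "norm (k m) = (\<Sum>s\<in>supp k. Re (cnj (sgn (k m)) * (k s * q s m)))" for m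
  proof -
    have "cnj (sgn (k m)) * k m = of_real (norm (k m))"
      by (simp add: sgn_eq complex_norm_square[symmetric] field_simps power2_eq_square mult.commute)
    then have "norm (k m) = Re (cnj (sgn (k m)) * (\<Sum>s\<in>supp k. k s * q s m))"
      using reproducing[OF k, of m] by (metis Re_complex_of_real)
    then show ?thesis by (simp only: sum_distrib_left Re_sum)
  qed
  have "(\<Sum>m\<in>?K. norm (k m)) = (\<Sum>s\<in>supp k. \<Sum>m\<in>?K. Re (cnj (sgn (k m)) * (k s * q s m)))"
    by (subst sum.swap) (intro sum.cong refl kn)
  then have "(\<Sum>s\<in>supp k. \<Sum>m\<in>?K. ?d s m)
      = (\<Sum>s\<in>supp k. norm (k s) * (\<Sum>m\<in>?K. norm (q s m))) - (\<Sum>m\<in>?K. norm (k m))"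
    by (simp only: sum_subtractf norm_mult sum_distrib_left)
  \<comment> \<open>Columns of norm at most 1 bound the total defect by the norm of \<open>k\<close>
    minus itself. As all defects are nonnegative, each one vanishes.\<close>
  also have "\<dots> \<le> (\<Sum>s\<in>supp k. norm (k s) * 1) - (\<Sum>m\<in>supp k. norm (k m))"
    using fin by (intro diff_mono sum_mono mult_left_mono column_norm_sum_le[OF k] sum_mono2) auto
  finally have "(\<Sum>s\<in>supp k. \<Sum>m\<in>?K. ?d s m) \<le> 0" by simp
  then have "(\<Sum>m\<in>?K. ?d s m) = 0"
    using s fin d0 by (intro sum_nonneg_0[of "supp k" "\<lambda>s. \<Sum>m\<in>?K. ?d s m"] sum_nonneg antisym) auto
  then have "?d s m = 0"
    using fin d0 by (intro sum_nonneg_0[of ?K "?d s"]) auto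
  then have "k s * q s m = sgn (k m) * norm (k s * q s m)"
    by (intro eq_mult_norm_if_norm_le_Re) (auto simp: norm_sgn)
  then show ?thesis
    using s by (simp add: supp_def sgn_eq norm_mult field_simps)
qed

text \<open>Replace the coefficients \<open>h s\<close> in the reproducing formula by
  \<open>sgn (k s) * norm (h s)\<close>. The result lies in \<open>F\<close>, and alignment of the
  columns with \<open>k\<close> turns it into \<open>sgn (k m) * b m\<close> with \<open>b m\<close>
  at least \<open>norm (h m)\<close>. Since columns have norm at most 1, \<open>b\<close> has no
  larger sum than \<open>norm (h m)\<close>, so the two agree.\<close>

lemma sgn_mult_norm_in:
  assumes k: "k \<in> F" and h: "h \<in> F" and sub: "supp h \<subseteq> supp k"
  shows "(\<lambda>m. sgn (k m) * norm (h m)) \<in> F"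
proof -
  define b where "b m = (\<Sum>s\<in>supp k. norm (h s) * norm (q s m))" for m
  have fin: "finite (supp k)" using finite_supp[OF k] .
  have g: "(\<lambda>m. \<Sum>s\<in>supp k. (sgn (k s) * norm (h s)) * q s m) \<in> F"
    using fin column[OF k] by (rule combination)
  have g_eq: "(\<Sum>s\<in>supp k. (sgn (k s) * norm (h s)) * q s m) = sgn (k m) * b m" for m
  proof -
    have "(\<Sum>s\<in>supp k. (sgn (k s) * norm (h s)) * q s m)
        = (\<Sum>s\<in>supp k. norm (h s) * (sgn (k s) * q s m))"
      by (simp add: mult_ac)
    also have "\<dots> = (\<Sum>s\<in>supp k. norm (h s) * (sgn (k m) * norm (q s m)))"
      by (simp add: column_aligned[OF k])
    finally show ?thesis by (simp add: b_def sum_distrib_left mult_ac)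
  qed
  have le: "norm (h m) \<le> b m" for m
    unfolding b_def reproducing_on[OF h fin sub, of m] norm_mult[symmetric] by (rule norm_sum)
  have "norm (h m) = b m" for m
  proof -
    let ?K = "insert m (supp k)"
    have "(\<Sum>m\<in>?K. b m) = (\<Sum>s\<in>supp k. norm (h s) * (\<Sum>m\<in>?K. norm (q s m)))"
      unfolding b_def by (subst sum.swap) (simp add: sum_distrib_left)
    also have "\<dots> \<le> (\<Sum>s\<in>supp k. norm (h s) * 1)"
      using fin by (intro sum_mono mult_left_mono column_norm_sum_le[OF k]) auto
    also have "\<dots> \<le> (\<Sum>m\<in>?K. norm (h m))"
      using fin by (auto intro!: sum_mono2)
    finally have "(\<Sum>m\<in>?K. b m - norm (h m)) \<le> 0" by (simp add: sum_subtractf)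
    then have "b m - norm (h m) = 0"
      using fin le by (intro sum_nonneg_0[of ?K "\<lambda>m. b m - norm (h m)"] antisym sum_nonneg) auto
    then show ?thesis by simp
  qed
  with g show ?thesis unfolding g_eq by simp
qed

text \<open>With a common phase \<open>sgn (k m)\<close> available on the union of the supports, the
  identity 2 min(a, b) = a + b - |a - b| produces an element of \<open>F\<close> whose modulus is
  twice the minimum of those of \<open>f\<close> and \<open>h\<close>.\<close>

lemma supp_inter:
  assumes f: "f \<in> F" and h: "h \<in> F"
  shows "\<exists>g\<in>F. supp g = supp f \<inter> supp h"
proof -
  \<comment> \<open>Avoiding these finitely many values prevents \<open>f\<close> and
    \<open>t * h\<close> from cancelling, so \<open>supp k\<close> is the union of both
    supports.\<close>
  obtain t where t: "t \<notin> insert 0 ((\<lambda>m. - f m / h m) ` supp h)"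
    using ex_new_if_finite[OF infinite_UNIV_char_0] finite_supp[OF h] by (metis finite_imageI finite_insert)
  define k where "k m = f m + t * h m" for m
  have k: "k \<in> F" unfolding k_def by (intro add scale f h)
  have k0: "k m = 0 \<longleftrightarrow> f m = 0 \<and> h m = 0" for m
  proof (cases "h m = 0")
    case False
    then have "t \<noteq> - f m / h m" using t by (auto simp: supp_def)
    then show ?thesis using False by (auto simp: k_def field_simps eq_neg_iff_add_eq_0)
  qed (simp add: k_def)
  \<comment> \<open>\<open>e\<close> is the phase of \<open>k\<close> times the real difference of
    the moduli. A second use of \<open>sgn_mult_norm_in\<close> yields the absolute value of that
    difference.\<close>
  define e where "e m = sgn (k m) * norm (f m) + (-1) * (sgn (k m) * norm (h m))" for m
  have A: "(\<lambda>m. sgn (k m) * norm (f m)) \<in> F" "(\<lambda>m. sgn (k m) * norm (h m)) \<in> F"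
    by (rule sgn_mult_norm_in[OF k f] sgn_mult_norm_in[OF k h]; auto simp: supp_def k0)+
  then have e: "e \<in> F" unfolding e_def by (intro add scale)
  have "(\<lambda>m. sgn (k m) * norm (e m)) \<in> F"
    by (rule sgn_mult_norm_in[OF k e]) (auto simp: supp_def e_def k0)
  then have g: "(\<lambda>m. (sgn (k m) * norm (f m) + sgn (k m) * norm (h m)) + (-1) * (sgn (k m) * norm (e m))) \<in> F"
    by (intro add scale A)
  have e_norm: "norm (e m) = \<bar>norm (f m) - norm (h m)\<bar>" for m
  proof -
    have "e m = sgn (k m) * of_real (norm (f m) - norm (h m))"
      by (simp add: e_def algebra_simps)
    then show ?thesis by (cases "k m = 0") (auto simp: norm_mult norm_sgn k0 simp del: of_real_diff)
  qed
  have "(sgn (k m) * norm (f m) + sgn (k m) * norm (h m)) + (-1) * (sgn (k m) * norm (e m))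
      = sgn (k m) * of_real (2 * min (norm (f m)) (norm (h m)))" for m
  proof -
    have "2 * min (norm (f m)) (norm (h m)) = norm (f m) + norm (h m) - norm (e m)"
      unfolding e_norm by (simp add: min_def abs_if)
    then show ?thesis by (simp only:) (simp add: algebra_simps)
  qed
  then show ?thesis
    using g by (intro bexI[OF _ g]) (auto simp: supp_def k0 sgn_zero_iff min_def)
qed

section \<open>Minimal supports\<close>

definition minimal :: "('b \<Rightarrow> complex) \<Rightarrow> bool" where
  "minimal f \<longleftrightarrow> f \<in> F \<and> supp f \<noteq> {} \<and>
     (\<forall>g\<in>F. supp g \<noteq> {} \<longrightarrow> supp g \<subseteq> supp f \<longrightarrow> supp g = supp f)"

text \<open>The intersection is itself a nonempty support of an element of \<open>F\<close>, so
  minimality makes it equal to both.\<close>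

lemma minimal_disjoint:
  assumes "minimal f" "minimal h" "supp f \<inter> supp h \<noteq> {}"
  shows "supp f = supp h"
proof -
  have "f \<in> F" "h \<in> F" using assms by (auto simp: minimal_def)
  then obtain g where "g \<in> F" "supp g = supp f \<inter> supp h" using supp_inter by blast
  with assms show ?thesis unfolding minimal_def by (metis Int_lower1 Int_lower2)
qed

text \<open>Supports are finite, so one of least cardinality exists among the nonempty ones inside
  \<open>supp f\<close>.\<close>

lemma minimal_exists:
  assumes "f \<in> F" "supp f \<noteq> {}"
  obtains h where "minimal h" "supp h \<subseteq> supp f"
proof -
  let ?P = "\<lambda>h. h \<in> F \<and> supp h \<noteq> {} \<and> supp h \<subseteq> supp f"
  obtain h where h: "?P h" "\<And>g. ?P g \<Longrightarrow> card (supp h) \<le> card (supp g)"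
    using ex_has_least_nat[of ?P f "\<lambda>h. card (supp h)"] assms by blast
  have "minimal h"
    unfolding minimal_def
  proof (intro conjI ballI impI)
    fix g assume g: "g \<in> F" "supp g \<noteq> {}" "supp g \<subseteq> supp h"
    then have "card (supp h) \<le> card (supp g)" using h by blast
    then show "supp g = supp h" using g h(1) finite_supp by (intro card_seteq) auto
  qed (use h in auto)
  with h that show ?thesis by blast
qed

end

section \<open>The lifting of the identity\<close>

text \<open>Generators of norm at most 1 make the operator contractive, and every \<open>x\<close>
  in the ball is the image of the unit vector at \<open>x\<close>, which has norm 1.\<close>

lemma coisometric_ext_unit_ball:
  assumes P: "complex_normed_space P"
  shows "strictly_coisometric (l1_0_space (unit_ball P)) P (complex_normed_space.ext P (\<lambda>b. b))"
proof -
  interpret P: complex_normed_space P by fact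
  define B where "B = unit_ball P"
  let ?L = "l1_0_space B" and ?\<pi> = "P.ext (\<lambda>b. b)"
  have B: "(\<lambda>b. b) \<in> B \<rightarrow> carrier P" "\<And>b. b \<in> B \<Longrightarrow> nrm P b \<le> 1"
    by (auto simp: B_def unit_ball_def)
  have "?\<pi> ` unit_ball ?L = B"
  proof (intro equalityI subsetI)
    fix x assume "x \<in> ?\<pi> ` unit_ball ?L"
    then show "x \<in> B"
      using P.ext_linear[OF B(1)] P.ext_nrm[OF B]
      by (force simp: B_def unit_ball_def linear_operator_def Pi_def)
  next
    fix x assume x: "x \<in> B"
    let ?d = "\<lambda>k. if k = x then 1 else 0 :: complex"
    have "?d \<in> unit_ball ?L"
      using x l1_0_nrm[of "{x}" ?d B] by (auto simp: unit_ball_def l1_0_carrier)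
    with P.ext_unit[OF B(1) x] show "x \<in> ?\<pi> ` unit_ball ?L" by (metis imageI)
  qed
  then show ?thesis by (simp add: strictly_coisometric_def B_def)
qed

text \<open>A lifting of the identity is contractive, and so is the canonical operator that it
  inverts on the right. Hence the lifting is isometric.\<close>

lemma metrically_projective_section:
  assumes P: "complex_normed_space P" and proj: "metrically_projective P"
  obtains \<sigma> where "linear_operator P (l1_0_space (unit_ball P)) \<sigma>"
    "\<And>x. x \<in> carrier P \<Longrightarrow> complex_normed_space.ext P (\<lambda>b. b) (\<sigma> x) = x"
    "\<And>x. x \<in> carrier P \<Longrightarrow> nrm (l1_0_space (unit_ball P)) (\<sigma> x) = nrm P x"
proof -
  interpret P: complex_normed_space P by fact
  let ?L = "l1_0_space (unit_ball P)" and ?\<pi> = "P.ext (\<lambda>b. b)"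
  have L: "complex_normed_space ?L" by (rule complex_normed_space_l1_0)
  have B: "(\<lambda>b. b) \<in> unit_ball P \<rightarrow> carrier P" "\<And>b. b \<in> unit_ball P \<Longrightarrow> nrm P b \<le> 1"
    by (auto simp: unit_ball_def)
  have id: "bounded_operator P P (\<lambda>x. x)"
    by (auto simp: bounded_operator_def linear_operator_def intro!: exI[of _ 1])
  obtain \<sigma> where sig: "bounded_operator P ?L \<sigma>" "\<And>x. x \<in> carrier P \<Longrightarrow> ?\<pi> (\<sigma> x) = x"
    "operator_norm P ?L \<sigma> = operator_norm P P (\<lambda>x. x)"
    using proj L P P.ext_linear[OF B(1)] coisometric_ext_unit_ball[OF P] id
    unfolding metrically_projective_def metrically_projective_wrt_def by blast
  have lin: "linear_operator P ?L \<sigma>" using sig(1) by (simp add: bounded_operator_def)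
  \<comment> \<open>An inequality, because on the zero space the identity has norm 0.\<close>
  have le1: "operator_norm P ?L \<sigma> \<le> 1"
    unfolding sig(3) by (rule operator_norm_le[OF P]) auto
  have "nrm ?L (\<sigma> x) = nrm P x" if x: "x \<in> carrier P" for x
  proof (rule antisym)
    have "nrm ?L (\<sigma> x) \<le> operator_norm P ?L \<sigma> * nrm P x"
      by (rule operator_norm_bound(2)[OF P L sig(1) x])
    also have "\<dots> \<le> 1 * nrm P x" by (intro mult_right_mono le1 P.nrm_nonneg x)
    finally show "nrm ?L (\<sigma> x) \<le> nrm P x" by simp
    have "\<sigma> x \<in> carrier ?L" using lin x by (auto simp: linear_operator_def)
    from P.ext_nrm[OF B this] show "nrm P x \<le> nrm ?L (\<sigma> x)" using sig(2)[OF x] by simp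
  qed
  with lin sig(2) that show ?thesis by blast
qed

section \<open>Metrically projective spaces\<close>

text \<open>Reverses direction: the operator is built from coefficients to \<open>P\<close>, whereas
  an isomorphism has to start at \<open>P\<close>. An isometric linear map has trivial kernel, and
  its inverse inherits linearity.\<close>

lemma isometrically_isomorphic_if_isometric_onto:
  assumes P: "complex_normed_space P" and W: "complex_normed_space W"
    and lin: "linear_operator W P T"
    and iso: "\<And>f. f \<in> carrier W \<Longrightarrow> nrm P (T f) = nrm W f"
    and onto: "carrier P \<subseteq> T ` carrier W"
  shows "isometrically_isomorphic P W"
proof -
  interpret P: complex_normed_space P by fact
  interpret W: complex_normed_space W by fact
  have TP: "T f \<in> carrier P" if "f \<in> carrier W" for f
    using lin that by (auto simp: linear_operator_def)
  have T_add: "T (f \<oplus>\<^bsub>W\<^esub> g) = T f \<oplus>\<^bsub>P\<^esub> T g" if "f \<in> carrier W" "g \<in> carrier W" for f g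
    using lin that by (auto simp: linear_operator_def)
  have T_smult: "T (c \<odot>\<^bsub>W\<^esub> f) = c \<odot>\<^bsub>P\<^esub> T f" if "f \<in> carrier W" for c f
    using lin that by (auto simp: linear_operator_def)
  have inj: "inj_on T (carrier W)"
  proof (rule inj_onI)
    fix f g assume f: "f \<in> carrier W" and g: "g \<in> carrier W" and eq: "T f = T g"
    have g': "\<ominus>\<^bsub>W\<^esub> g \<in> carrier W" using g by simp
    have "T (f \<oplus>\<^bsub>W\<^esub> \<ominus>\<^bsub>W\<^esub> g) = T (g \<oplus>\<^bsub>W\<^esub> \<ominus>\<^bsub>W\<^esub> g)"
      using T_add f g g' eq by simp
    also have "\<dots> = \<zero>\<^bsub>P\<^esub>" using g by (simp add: W.r_neg linear_operator_zero[OF W P lin])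
    finally have "nrm W (f \<oplus>\<^bsub>W\<^esub> \<ominus>\<^bsub>W\<^esub> g) = 0"
      using iso[of "f \<oplus>\<^bsub>W\<^esub> \<ominus>\<^bsub>W\<^esub> g"] f g' by simp
    then have "f \<oplus>\<^bsub>W\<^esub> \<ominus>\<^bsub>W\<^esub> g = \<zero>\<^bsub>W\<^esub>" using W.nrm_eq_zero_iff f g' by simp
    then show "f = g" using f g W.minus_equality[of f "\<ominus>\<^bsub>W\<^esub> g"] g' by simp
  qed
  define S where "S = inv_into (carrier W) T"
  have im: "T ` carrier W = carrier P" using onto TP by blast
  have SW: "S x \<in> carrier W" and TS: "T (S x) = x" if "x \<in> carrier P" for x
    using that im unfolding S_def by (auto intro: inv_into_into f_inv_into_f)
  have ST: "S (T f) = f" if "f \<in> carrier W" for f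
    using inj that by (simp add: S_def)
  have "linear_operator P W S"
    unfolding linear_operator_def
  proof (intro conjI ballI allI funcsetI)
    fix x y assume xy: "x \<in> carrier P" "y \<in> carrier P"
    have "S (T (S x \<oplus>\<^bsub>W\<^esub> S y)) = S x \<oplus>\<^bsub>W\<^esub> S y" using xy SW by (intro ST) simp
    then show "S (x \<oplus>\<^bsub>P\<^esub> y) = S x \<oplus>\<^bsub>W\<^esub> S y" using xy by (simp add: T_add SW TS)
  next
    fix c x assume x: "x \<in> carrier P"
    have "S (T (c \<odot>\<^bsub>W\<^esub> S x)) = c \<odot>\<^bsub>W\<^esub> S x"
      using x SW by (intro ST W.smult_in_carrier)
    then show "S (c \<odot>\<^bsub>P\<^esub> x) = c \<odot>\<^bsub>W\<^esub> S x" using x by (simp add: T_smult SW TS)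
  qed (rule SW)
  moreover have "bij_betw S (carrier P) (carrier W)"
    unfolding S_def using inj im by (intro bij_betw_inv_into) (simp add: bij_betw_def)
  moreover have "nrm W (S x) = nrm P x" if "x \<in> carrier P" for x
    using iso[OF SW[OF that]] TS[OF that] by simp
  ultimately show ?thesis unfolding isometrically_isomorphic_def by blast
qed

theorem theorem3p5:
  fixes P :: "'p normed_module"
  assumes "complex_normed_space P"
    and "metrically_projective P"
  shows "\<exists>M :: 'p set. isometrically_isomorphic P (l1_0_space M)"
proof -
  interpret P: complex_normed_space P by fact

  \<comment> \<open>The section and its range\<close>
  define B where "B = unit_ball P"
  define L where "L = l1_0_space B"
  obtain \<sigma> where lin: "linear_operator P L \<sigma>"
    and sec: "\<And>x. x \<in> carrier P \<Longrightarrow> P.ext (\<lambda>b. b) (\<sigma> x) = x"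
    and iso: "\<And>x. x \<in> carrier P \<Longrightarrow> nrm L (\<sigma> x) = nrm P x"
    using metrically_projective_section[OF assms] unfolding L_def B_def by blast
  have BP: "b \<in> carrier P" "nrm P b \<le> 1" if "b \<in> B" for b
    using that by (auto simp: B_def unit_ball_def)
  have sigL: "finite (supp (\<sigma> x))" "supp (\<sigma> x) \<subseteq> B" if "x \<in> carrier P" for x
  proof -
    have "\<sigma> x \<in> carrier L" using lin that by (auto simp: linear_operator_def)
    then show "finite (supp (\<sigma> x))" "supp (\<sigma> x) \<subseteq> B" by (auto simp: L_def l1_0_carrier supp_def)
  qed
  have sig_add: "\<sigma> (x \<oplus>\<^bsub>P\<^esub> y) = (\<lambda>m. \<sigma> x m + \<sigma> y m)"
    if "x \<in> carrier P" "y \<in> carrier P" for x y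
    using lin that by (simp add: linear_operator_def L_def)
  have sig_smult: "\<sigma> (c \<odot>\<^bsub>P\<^esub> x) = (\<lambda>m. c * \<sigma> x m)" if "x \<in> carrier P" for c x
    using lin that by (simp add: linear_operator_def L_def)
  have sig_zero: "\<sigma> \<zero>\<^bsub>P\<^esub> = (\<lambda>m. 0)"
    using linear_operator_zero[OF assms(1) _ lin] complex_normed_space_l1_0[of B] by (simp add: L_def)
  have sig_sum: "\<sigma> (\<Oplus>\<^bsub>P\<^esub>a\<in>A. c a \<odot>\<^bsub>P\<^esub> a) m = (\<Sum>a\<in>A. c a * \<sigma> a m)"
    if "finite A" "A \<subseteq> carrier P" for c m A
    using that
  proof (induction A rule: finite_induct)
    case (insert a A)
    then have "(\<lambda>a. c a \<odot>\<^bsub>P\<^esub> a) \<in> A \<rightarrow> carrier P" "c a \<odot>\<^bsub>P\<^esub> a \<in> carrier P"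
      using P.smult_in_carrier by auto
    then show ?case
      using insert by (simp add: sig_add sig_smult)
  qed (simp add: sig_zero)
  have nrm_on: "nrm P x = (\<Sum>m\<in>A. norm (\<sigma> x m))"
    if "x \<in> carrier P" "finite A" "supp (\<sigma> x) \<subseteq> A" "A \<subseteq> B" for x A
    using l1_0_nrm[of A "\<sigma> x" B] iso that by (simp add: L_def supp_def)
  have nrm_supp: "nrm P x = (\<Sum>m\<in>supp (\<sigma> x). norm (\<sigma> x m))" if "x \<in> carrier P" for x
    using that sigL[OF that] by (intro nrm_on) auto
  have supp_empty: "x = \<zero>\<^bsub>P\<^esub>" if "x \<in> carrier P" "supp (\<sigma> x) = {}" for x
    using nrm_supp[OF that(1)] that P.nrm_eq_zero_iff by simp

  \<comment> \<open>Points of \<open>B\<close> are themselves vectors of \<open>P\<close>: the unit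
    vector at \<open>s\<close> is sent to \<open>s\<close> and then to \<open>\<sigma> s\<close>. So
    \<open>\<sigma>\<close> doubles as the family of columns, meaningful at points of supports since
    these lie in \<open>B\<close>.\<close>
  interpret contractive_projection_range "\<sigma> ` carrier P" \<sigma>
  proof
    show "(\<lambda>m. 0) \<in> \<sigma> ` carrier P" unfolding sig_zero[symmetric] by (rule imageI) simp
    show "(\<lambda>m. c * f m) \<in> \<sigma> ` carrier P" if "f \<in> \<sigma> ` carrier P" for c f
      using that by (auto simp: sig_smult[symmetric] intro!: imageI P.smult_in_carrier)
    show "(\<lambda>m. f m + g m) \<in> \<sigma> ` carrier P" if "f \<in> \<sigma> ` carrier P" "g \<in> \<sigma> ` carrier P" for f g
      using that by (auto simp: sig_add[symmetric])
    show "finite (supp f)" if "f \<in> \<sigma> ` carrier P" for f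
      using that sigL by auto
    show "\<sigma> s \<in> \<sigma> ` carrier P" if "f \<in> \<sigma> ` carrier P" "s \<in> supp f" for f s
      using that sigL BP by blast
    show "(\<Sum>m\<in>supp (\<sigma> s). norm (\<sigma> s m)) \<le> 1" if "f \<in> \<sigma> ` carrier P" "s \<in> supp f" for f s
    proof -
      have "s \<in> B" using that sigL by blast
      then show ?thesis using nrm_supp[OF BP(1), of s] BP(2)[of s] by simp
    qed
    show "f m = (\<Sum>s\<in>supp f. f s * \<sigma> s m)" if "f \<in> \<sigma> ` carrier P" for f m
    proof -
      obtain x where x: "x \<in> carrier P" "f = \<sigma> x" using \<open>f \<in> _\<close> by blast
      \<comment> \<open>The projection fixes its range. Expanding it linearly gives the reproducing
        formula.\<close>
      have "f m = \<sigma> (P.ext (\<lambda>b. b) f) m" using sec x by simp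
      also have "\<dots> = (\<Sum>s\<in>supp f. f s * \<sigma> s m)"
        unfolding P.ext_def supp_def[symmetric]
        using sigL[OF x(1)] BP x(2) by (intro sig_sum) auto
      finally show ?thesis .
    qed
  qed

  \<comment> \<open>One normalized vector per minimal support\<close>
  define R where "R x \<longleftrightarrow> x \<in> carrier P \<and> nrm P x = 1 \<and> minimal (\<sigma> x)" for x
  \<comment> \<open>The choice depends on the support alone, so elements of \<open>M\<close> with
    equal supports coincide.\<close>
  define rep where "rep S = (SOME x. R x \<and> supp (\<sigma> x) = S)" for S
  define M where "M = {x. R x \<and> x = rep (supp (\<sigma> x))}"
  have MP: "M \<subseteq> carrier P" and M1: "x \<in> M \<Longrightarrow> nrm P x = 1" and
    Mmin: "x \<in> M \<Longrightarrow> minimal (\<sigma> x)" for x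
    by (auto simp: M_def R_def)
  have M_disj: "x = y" if "x \<in> M" "y \<in> M" "\<sigma> x b \<noteq> 0" "\<sigma> y b \<noteq> 0" for x y b
  proof -
    have "supp (\<sigma> x) \<inter> supp (\<sigma> y) \<noteq> {}" using that by (auto simp: supp_def)
    from minimal_disjoint[OF Mmin[OF that(1)] Mmin[OF that(2)] this] that show ?thesis
      unfolding M_def by auto
  qed
  have M_ex: "\<exists>z\<in>M. supp (\<sigma> z) = supp h" if h: "minimal h" for h
  proof -
    obtain x where x: "x \<in> carrier P" "h = \<sigma> x" using h by (auto simp: minimal_def)
    have "nrm P x \<noteq> 0"
      using h P.nrm_eq_zero_iff[OF x(1)] sig_zero unfolding minimal_def x(2) by (auto simp: supp_def)
    then have n: "nrm P x > 0" using P.nrm_nonneg[OF x(1)] by simp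
    define c where "c = complex_of_real (1 / nrm P x)"
    have c: "c \<noteq> 0" "norm c = 1 / nrm P x" using n by (auto simp: c_def norm_divide)
    have s: "supp (\<sigma> (c \<odot>\<^bsub>P\<^esub> x)) = supp h"
      using c by (simp add: sig_smult x supp_def)
    have "R (c \<odot>\<^bsub>P\<^esub> x)"
      using h s n P.smult_in_carrier[OF x(1), of c] unfolding R_def minimal_def
      by (simp add: P.nrm_smult[OF x(1)] c(2))
    with s have "R (rep (supp h)) \<and> supp (\<sigma> (rep (supp h))) = supp h"
      unfolding rep_def by (metis (mono_tags, lifting) someI)
    then show ?thesis unfolding M_def by (intro bexI[of _ "rep (supp h)"]) auto
  qed

  \<comment> \<open>Isometry of the linear extension\<close>
  let ?W = "l1_0_space M" and ?T = "P.ext (\<lambda>b. b)"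
  have W: "complex_normed_space ?W" by (rule complex_normed_space_l1_0)
  interpret W: complex_normed_space ?W by fact
  have idM: "(\<lambda>b. b) \<in> M \<rightarrow> carrier P" using MP by auto
  have T_lin: "linear_operator ?W P ?T" by (rule P.ext_linear[OF idM])
  have T_iso: "nrm P (?T f) = nrm ?W f" if f: "f \<in> carrier ?W" for f
  proof -
    have A: "finite (supp f)" "supp f \<subseteq> M" using f by (auto simp: l1_0_carrier supp_def)
    have Tf: "?T f \<in> carrier P" using T_lin f by (auto simp: linear_operator_def)
    have sT: "\<sigma> (?T f) b = (\<Sum>m\<in>supp f. f m * \<sigma> m b)" for b
      unfolding P.ext_def supp_def[symmetric] using A MP by (intro sig_sum) auto
    define K where "K = (\<Union>m\<in>supp f. supp (\<sigma> m))"
    have K_sub: "supp (\<sigma> m) \<subseteq> K" if "m \<in> supp f" for m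
      using that unfolding K_def by blast
    have K: "finite K" "K \<subseteq> B" using A MP sigL unfolding K_def by blast+
    have "\<sigma> (?T f) b = 0" if "b \<notin> K" for b
      unfolding sT using that by (intro sum.neutral) (auto simp: K_def supp_def)
    then have "supp (\<sigma> (?T f)) \<subseteq> K" by (auto simp: supp_def)
    then have "nrm P (?T f) = (\<Sum>b\<in>K. norm (\<sigma> (?T f) b))"
      by (intro nrm_on Tf K)
    \<comment> \<open>By \<open>M_disj\<close> at most one summand is nonzero at each coordinate
      \<open>b\<close>.\<close>
    also have "\<dots> = (\<Sum>b\<in>K. \<Sum>m\<in>supp f. norm (f m) * norm (\<sigma> m b))"
      unfolding sT norm_mult[symmetric]
      by (intro sum.cong refl norm_sum_at_most_one_nonzero A) (use A M_disj in \<open>simp; blast\<close>)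
    also have "\<dots> = (\<Sum>m\<in>supp f. norm (f m) * (\<Sum>b\<in>K. norm (\<sigma> m b)))"
      by (subst sum.swap) (simp add: sum_distrib_left)
    also have "\<dots> = (\<Sum>m\<in>supp f. norm (f m) * nrm P m)"
      using A MP K K_sub by (intro sum.cong refl arg_cong2[of _ _ _ _ "(*)"] nrm_on[symmetric]) auto
    also have "\<dots> = (\<Sum>m\<in>supp f. norm (f m))"
      using A M1 by (intro sum.cong) auto
    also have "\<dots> = nrm ?W f"
      using A by (intro l1_0_nrm[symmetric]) (auto simp: supp_def)
    finally show ?thesis .
  qed

  \<comment> \<open>Surjectivity by induction on the size of the support\<close>
  have "x \<in> ?T ` carrier ?W" if "x \<in> carrier P" for x
    using that
  proof (induction "card (supp (\<sigma> x))" arbitrary: x rule: less_induct)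
    case less
    show ?case
    proof (cases "supp (\<sigma> x) = {}")
      case True
      then show ?thesis
        using supp_empty[OF less.prems] linear_operator_zero[OF W assms(1) T_lin] W.zero_closed
        by (metis imageI)
    next
      case False
      then obtain h where h: "minimal h" "supp h \<subseteq> supp (\<sigma> x)"
        using minimal_exists[of "\<sigma> x"] less.prems by blast
      then obtain z where z: "z \<in> M" "supp (\<sigma> z) = supp h" using M_ex by blast
      have zP: "z \<in> carrier P" using z MP by blast
      obtain b where b: "b \<in> supp h" using h by (auto simp: minimal_def)
      \<comment> \<open>This multiple of \<open>z\<close> cancels the coordinate \<open>b\<close> of
        \<open>\<sigma> x\<close>. No new coordinate appears because
        \<open>supp (\<sigma> z)\<close> lies in \<open>supp (\<sigma> x)\<close>, so the support
        shrinks strictly.\<close>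
      define c where "c = \<sigma> x b / \<sigma> z b"
      define y where "y = x \<oplus>\<^bsub>P\<^esub> (- c) \<odot>\<^bsub>P\<^esub> z"
      have yP: "y \<in> carrier P" unfolding y_def using less.prems zP P.smult_in_carrier by simp
      have sy: "\<sigma> y = (\<lambda>m. \<sigma> x m - c * \<sigma> z m)"
        unfolding y_def using less.prems zP P.smult_in_carrier by (simp add: sig_add sig_smult)
      have "\<sigma> z b \<noteq> 0" using b z by (auto simp: supp_def)
      then have "b \<notin> supp (\<sigma> y)" "b \<in> supp (\<sigma> x)"
        using b h by (auto simp: sy c_def supp_def)
      moreover have "supp (\<sigma> y) \<subseteq> supp (\<sigma> x)"
        using z(2) h(2) by (auto simp: sy supp_def)
      ultimately have "card (supp (\<sigma> y)) < card (supp (\<sigma> x))"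
        using sigL(1)[OF less.prems] by (intro psubset_card_mono) auto
      then obtain g where g: "g \<in> carrier ?W" "y = ?T g" using less.hyps yP by blast
      let ?d = "\<lambda>k. if k = z then 1 else 0 :: complex"
      have d: "?d \<in> carrier ?W" using z by (auto simp: l1_0_carrier)
      have cd: "c \<odot>\<^bsub>?W\<^esub> ?d \<in> carrier ?W" by (rule W.smult_in_carrier[OF d])
      have "?T (g \<oplus>\<^bsub>?W\<^esub> c \<odot>\<^bsub>?W\<^esub> ?d) = ?T g \<oplus>\<^bsub>P\<^esub> ?T (c \<odot>\<^bsub>?W\<^esub> ?d)"
        using T_lin g(1) cd unfolding linear_operator_def by blast
      also have "?T (c \<odot>\<^bsub>?W\<^esub> ?d) = c \<odot>\<^bsub>P\<^esub> ?T ?d"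
        using T_lin d unfolding linear_operator_def by blast
      also have "?T ?d = z" by (rule P.ext_unit[OF idM z(1)])
      also have "?T g = y" using g by simp
      also have "y \<oplus>\<^bsub>P\<^esub> c \<odot>\<^bsub>P\<^esub> z = x"
      proof -
        have "(- c) \<odot>\<^bsub>P\<^esub> z \<oplus>\<^bsub>P\<^esub> c \<odot>\<^bsub>P\<^esub> z = \<zero>\<^bsub>P\<^esub>"
          using P.smult_l_distr[of "- c" c z] P.smult_l_null[OF zP] zP by simp
        then show ?thesis
          unfolding y_def using less.prems P.smult_in_carrier[OF zP] by (simp add: P.a_assoc)
      qed
      finally show ?thesis using W.a_closed[OF g(1) cd] by (metis imageI)
    qed
  qed
  then have "isometrically_isomorphic P ?W"
    by (intro isometrically_isomorphic_if_isometric_onto[OF assms(1) W T_lin T_iso]) auto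
  then show ?thesis by blast
qed

end
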